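(* Let $R$ be a monotone transit function on a finite non-empty set $V$. If the $R$-convexity $\mathcal{C}_R$ is a convex geometry, then $R$ satisfies the axioms $(b1)$ and $(J0)$.
   Context: A transit function on a finite non-empty set $V$ is a map $R:V\times V\to 2^V$ such that $u\in R(u,v)$, $R(u,v)=R(v,u)$ and $R(u,u)=\{u\}$ for all $u,v\in V$. A convexity on the finite set $V$ is a family of subsets of $V$ (called convex sets) containing $\emptyset$ and $V$ and closed under intersections; the convex hull of $A\subseteq V$ is the smallest convex set containing $A$. A set $S\subseteq V$ is $R$-convex if $R(u,v)\subseteq S$ for all $u,v\in S$; $\mathcal{C}_R$ denotes the convexity of all $R$-convex subsets of $V$. A point $k$ of a convex set $K$ is an extreme point of $K$ if $K\setminus\{k\}$ is convex. A convexity is a convex geometry if every convex set $K$ is the convex hull of the set of extreme points of $K$. Axioms on $R$: - monotone, axiom $(m)$: for all $u,v,x,y\in V$, if $x,y\in R(u,v)$ then $R(x,y)\subseteq R(u,v)$. - $(b1)$: for all $u,v,x\in V$, if $x\in R(u,v)$ and $x\neq v$, then $v\notin R(u,x)$. - $(J0)$: for all pairwise distinct $u,v,x,y\in V$, if $x\in R(u,y)$ and $y\in R(x,v)$, then $x\in R(u,v)$. *)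

theory Defs
  imports Complex_Main
begin

text \<open>
  The ground set is an explicit carrier \<open>V\<close>; transit functions are total functions on the type that are
  only constrained, and only inspected, on \<open>V\<close>.  Finiteness and non-emptiness of \<open>V\<close> are separate
  hypotheses rather than part of these definitions.
\<close>

definition transit_function :: "'a set \<Rightarrow> ('a \<Rightarrow> 'a \<Rightarrow> 'a set) \<Rightarrow> bool" where
  "transit_function V R \<longleftrightarrow>
     (\<forall>u\<in>V. \<forall>v\<in>V. R u v \<subseteq> V \<and> u \<in> R u v \<and> R u v = R v u) \<and> (\<forall>u\<in>V. R u u = {u})"

definition convexity :: "'a set \<Rightarrow> 'a set set \<Rightarrow> bool" where
  "convexity V \<C> \<longleftrightarrow>
     \<C> \<subseteq> Pow V \<and> {} \<in> \<C> \<and> V \<in> \<C> \<and> (\<forall>\<A>. \<A> \<subseteq> \<C> \<and> \<A> \<noteq> {} \<longrightarrow> \<Inter>\<A> \<in> \<C>)"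

definition convex_hull_in :: "'a set set \<Rightarrow> 'a set \<Rightarrow> 'a set" where
  "convex_hull_in \<C> A = (\<lambda>K. K \<in> \<C>) hull A"

definition extreme_points :: "'a set set \<Rightarrow> 'a set \<Rightarrow> 'a set" where
  "extreme_points \<C> K = {k \<in> K. K - {k} \<in> \<C>}"

definition convex_geometry :: "'a set \<Rightarrow> 'a set set \<Rightarrow> bool" where
  "convex_geometry V \<C> \<longleftrightarrow>
     convexity V \<C> \<and> (\<forall>K\<in>\<C>. K = convex_hull_in \<C> (extreme_points \<C> K))"

definition R_convexity :: "'a set \<Rightarrow> ('a \<Rightarrow> 'a \<Rightarrow> 'a set) \<Rightarrow> 'a set set" where
  "R_convexity V R = {S. S \<subseteq> V \<and> (\<forall>u\<in>S. \<forall>v\<in>S. R u v \<subseteq> S)}"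

definition monotone_transit :: "'a set \<Rightarrow> ('a \<Rightarrow> 'a \<Rightarrow> 'a set) \<Rightarrow> bool" where
  "monotone_transit V R \<longleftrightarrow>
     (\<forall>u\<in>V. \<forall>v\<in>V. \<forall>x\<in>V. \<forall>y\<in>V. x \<in> R u v \<and> y \<in> R u v \<longrightarrow> R x y \<subseteq> R u v)"

definition axiom_b1 :: "'a set \<Rightarrow> ('a \<Rightarrow> 'a \<Rightarrow> 'a set) \<Rightarrow> bool" where
  "axiom_b1 V R \<longleftrightarrow>
     (\<forall>u\<in>V. \<forall>v\<in>V. \<forall>x\<in>V. x \<in> R u v \<and> x \<noteq> v \<longrightarrow> v \<notin> R u x)"

definition axiom_J0 :: "'a set \<Rightarrow> ('a \<Rightarrow> 'a \<Rightarrow> 'a set) \<Rightarrow> bool" where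
  "axiom_J0 V R \<longleftrightarrow>
     (\<forall>u\<in>V. \<forall>v\<in>V. \<forall>x\<in>V. \<forall>y\<in>V.
        distinct [u, v, x, y] \<and> x \<in> R u y \<and> y \<in> R x v \<longrightarrow> x \<in> R u v)"

lemma convex_hull_in_least:
  assumes "convexity V \<C>" and "A \<subseteq> V"
  shows "convex_hull_in \<C> A \<in> \<C>" and "A \<subseteq> convex_hull_in \<C> A"
    and "\<And>K. K \<in> \<C> \<Longrightarrow> A \<subseteq> K \<Longrightarrow> convex_hull_in \<C> A \<subseteq> K"
proof -
  have "{K. K \<in> \<C> \<and> A \<subseteq> K} \<subseteq> \<C>" "{K. K \<in> \<C> \<and> A \<subseteq> K} \<noteq> {}"
    using assms by (auto simp: convexity_def)
  then have "\<Inter>{K. K \<in> \<C> \<and> A \<subseteq> K} \<in> \<C>"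
    using assms(1) by (metis convexity_def)
  then show "convex_hull_in \<C> A \<in> \<C>"
    by (simp add: convex_hull_in_def hull_def)
qed (auto simp: convex_hull_in_def hull_def)

lemma convexity_R_convexity:
  assumes "transit_function V R"
  shows "convexity V (R_convexity V R)"
  unfolding convexity_def
proof (intro conjI allI impI)
  show "V \<in> R_convexity V R"
    using assms by (simp add: R_convexity_def transit_function_def)
  fix \<A> assume "\<A> \<subseteq> R_convexity V R \<and> \<A> \<noteq> {}"
  then show "\<Inter>\<A> \<in> R_convexity V R"
    unfolding R_convexity_def by (intro CollectI conjI ballI) (fast, blast)
qed (auto simp: R_convexity_def)

end

theory Submission
  imports Defs
begin

text \<open>
  An extreme point of the convex hull of \<open>A\<close> lies in \<open>A\<close>, and a point \<open>k \<in> R a b\<close> with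
  \<open>a, b \<noteq> k\<close> is extreme in no convex set containing \<open>a\<close> and \<open>b\<close>. If (b1) fails at \<open>u, v, x\<close>, the hull
  of \<open>{u, v, x}\<close> has no extreme point besides \<open>u\<close>, so it is \<open>{u}\<close>. For (J0), the hull of
  \<open>{u, v, x, y}\<close> has no extreme points besides \<open>u\<close> and \<open>v\<close>, so it lies in \<open>R u v\<close>, which is
  convex by monotonicity.
\<close>

text \<open>Deleting an extreme point outside \<open>A\<close> from the hull would leave a smaller
  convex set still containing \<open>A\<close>.\<close>

lemma extreme_points_hull_subset:
  assumes "convexity V \<C>" and "A \<subseteq> V"
  shows "extreme_points \<C> (convex_hull_in \<C> A) \<subseteq> A"
proof
  fix k assume k: "k \<in> extreme_points \<C> (convex_hull_in \<C> A)"
  show "k \<in> A"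
  proof (rule ccontr)
    assume "k \<notin> A"
    then have "A \<subseteq> convex_hull_in \<C> A - {k}"
      using convex_hull_in_least(2)[OF assms] by blast
    with k have "convex_hull_in \<C> A \<subseteq> convex_hull_in \<C> A - {k}"
      by (intro convex_hull_in_least(3)[OF assms]) (auto simp: extreme_points_def)
    with k show False
      by (auto simp: extreme_points_def)
  qed
qed

text \<open>The hull of \<open>A\<close> is generated by its extreme points, all of which lie in
  \<open>A\<close>. To trap \<open>A\<close> in a convex set \<open>C\<close>, it thus suffices to
  rule out as extreme the points of \<open>A\<close> not known to be in \<open>C\<close>.\<close>

lemma convex_geometry_subset:
  assumes "convex_geometry V \<C>" and "A \<subseteq> V" and "C \<in> \<C>"
    and "\<And>a. a \<in> A \<Longrightarrow> a \<in> extreme_points \<C> (convex_hull_in \<C> A) \<Longrightarrow> a \<in> C"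
  shows "A \<subseteq> C"
proof -
  let ?K = "convex_hull_in \<C> A"
  have conv: "convexity V \<C>"
    using assms(1) by (simp add: convex_geometry_def)
  have E: "extreme_points \<C> ?K \<subseteq> A"
    using extreme_points_hull_subset[OF conv assms(2)] .
  have "A \<subseteq> ?K"
    using convex_hull_in_least(2)[OF conv assms(2)] .
  also have "?K = convex_hull_in \<C> (extreme_points \<C> ?K)"
    using assms(1) convex_hull_in_least(1)[OF conv assms(2)] by (auto simp: convex_geometry_def)
  also have "\<dots> \<subseteq> C"
    using E assms(2-4) by (intro convex_hull_in_least(3)[OF conv]) auto
  finally show ?thesis .
qed

text \<open>Removing \<open>k\<close> keeps \<open>a\<close> and \<open>b\<close> but loses a point
  of \<open>R a b\<close>.\<close>

lemma not_extreme_between: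
  assumes "k \<in> R a b" and "a \<in> K" and "b \<in> K" and "a \<noteq> k" and "b \<noteq> k"
  shows "k \<notin> extreme_points (R_convexity V R) K"
  using assms by (auto simp: extreme_points_def R_convexity_def)

lemma convex_geometry_axiom_b1:
  assumes tf: "transit_function V R" and cg: "convex_geometry V (R_convexity V R)"
  shows "axiom_b1 V R"
  unfolding axiom_b1_def
proof (intro ballI impI notI)
  fix u v x
  assume V: "u \<in> V" "v \<in> V" "x \<in> V" and x: "x \<in> R u v \<and> x \<noteq> v" and v: "v \<in> R u x"
  let ?A = "{u, v, x}" and ?C = "R_convexity V R"
  have "R u u = {u}"
    using tf V by (simp add: transit_function_def)
  \<comment> \<open>Either equality \<open>u = v\<close> or \<open>u = x\<close> would put the third
    point into \<open>R u u = {u}\<close>, forcing \<open>x = v\<close>.\<close>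
  then have ne: "u \<noteq> v" "u \<noteq> x" "{u} \<in> ?C"
    using x v V by (auto simp: R_convexity_def)
  have A: "?A \<subseteq> V"
    using V by simp
  then have K: "?A \<subseteq> convex_hull_in ?C ?A"
    by (rule convex_hull_in_least(2)[OF convexity_R_convexity[OF tf]])
  have "v \<notin> extreme_points ?C (convex_hull_in ?C ?A)"
    using K x v ne by (intro not_extreme_between[of v R u x]) auto
  moreover have "x \<notin> extreme_points ?C (convex_hull_in ?C ?A)"
    using K x ne by (intro not_extreme_between[of x R u v]) auto
  ultimately have "?A \<subseteq> {u}"
    by (intro convex_geometry_subset[OF cg A ne(3)]) auto
  with ne show False
    by auto
qed

lemma convex_geometry_axiom_J0:
  assumes tf: "transit_function V R" and mono: "monotone_transit V R"
    and cg: "convex_geometry V (R_convexity V R)"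
  shows "axiom_J0 V R"
  unfolding axiom_J0_def
proof (intro ballI impI)
  fix u v x y
  assume V: "u \<in> V" "v \<in> V" "x \<in> V" "y \<in> V"
    and xy: "distinct [u, v, x, y] \<and> x \<in> R u y \<and> y \<in> R x v"
  let ?A = "{u, v, x, y}" and ?C = "R_convexity V R"
  have Ruv: "R u v \<subseteq> V" "u \<in> R u v" "v \<in> R u v"
    using tf V by (auto simp: transit_function_def)
  then have C: "R u v \<in> ?C"
    using mono V unfolding R_convexity_def monotone_transit_def by blast
  have A: "?A \<subseteq> V"
    using V by simp
  then have K: "?A \<subseteq> convex_hull_in ?C ?A"
    by (rule convex_hull_in_least(2)[OF convexity_R_convexity[OF tf]])
  \<comment> \<open>Distinctness makes \<open>x\<close> differ from both \<open>u\<close> and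
    \<open>y\<close>, and \<open>y\<close> from both \<open>x\<close> and \<open>v\<close>, so
    neither is extreme.\<close>
  have "x \<notin> extreme_points ?C (convex_hull_in ?C ?A)"
    using K xy by (intro not_extreme_between[of x R u y]) auto
  moreover have "y \<notin> extreme_points ?C (convex_hull_in ?C ?A)"
    using K xy by (intro not_extreme_between[of y R x v]) auto
  ultimately have "?A \<subseteq> R u v"
    using Ruv by (intro convex_geometry_subset[OF cg A C]) auto
  then show "x \<in> R u v"
    by simp
qed

theorem theorem2p1:
  fixes V :: "'a set" and R :: "'a \<Rightarrow> 'a \<Rightarrow> 'a set"
  assumes "finite V" and "V \<noteq> {}"
    and "transit_function V R"
    and "monotone_transit V R"
    and "convex_geometry V (R_convexity V R)"
  shows "axiom_b1 V R \<and> axiom_J0 V R"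
  using assms convex_geometry_axiom_b1 convex_geometry_axiom_J0 by blast

end
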